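(* Let $q$ be a complex number with $|q|<1$. Then $$\sum_{n\ge 0}\frac{(-q;q^2)_n\,q^{n^2+n}}{(q;q)_{2n+1}}=\frac{(-q^2;q^2)_\infty}{(q;q^2)_\infty}=\frac{(q^4;q^4)_\infty}{(q;q)_\infty}.$$
   Context: For $n\in\mathbb Z_{\ge 0}\cup\{\infty\}$, $(a;q)_n:=\prod_{j=0}^{n-1}(1-aq^j)$ (and similarly with base $q$ replaced by a power of $q$). *)

theory Defs
  imports "HOL-Analysis.Analysis"
begin

definition qpoch :: "complex \<Rightarrow> complex \<Rightarrow> nat \<Rightarrow> complex" where
  "qpoch a q n = (\<Prod>j<n. 1 - a * q ^ j)"

definition qpoch_inf :: "complex \<Rightarrow> complex \<Rightarrow> complex" where
  "qpoch_inf a q = (\<Prod>j. 1 - a * q ^ j)"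

text \<open>For \<open>norm q < 1\<close> the infinite product converges, so \<open>prodinf\<close> carries its intended meaning.\<close>

lemma has_prod_qpoch_inf:
  assumes "norm q < 1"
  shows "(\<lambda>j. 1 - a * q ^ j) has_prod qpoch_inf a q"
proof -
  have "summable (\<lambda>j. norm a * norm q ^ j)"
    using assms by (intro summable_mult summable_geometric) simp
  then have "abs_convergent_prod (\<lambda>j. 1 - a * q ^ j)"
    by (simp add: abs_convergent_prod_conv_summable norm_mult norm_power)
  then show ?thesis
    unfolding qpoch_inf_def
    by (intro convergent_prod_has_prod abs_convergent_prod_imp_convergent_prod)
qed

end

theory Submission
  imports Defs
begin

text \<open>
  With base \<open>Q = q\<^sup>2\<close> the sum is \<open>1/(1-q)\<close> times the \<open>\<^sub>1\<phi>\<^sub>1\<close> series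
  \<open>S(z) = \<Sum>n. (a;Q)\<^sub>n (-z)\<^sup>n Q^(n choose 2) / ((az;Q)\<^sub>n (Q;Q)\<^sub>n)\<close> at \<open>a = -q\<close>, \<open>z = -q\<^sup>2\<close>.
  Writing \<open>u\<^sub>n\<close> for the terms, \<open>S(z) - (1-z)/(1-az) S(zQ)\<close> telescopes with
  certificate \<open>u\<^sub>n (1-Q\<^sup>n)\<close>, so it vanishes. Iterating, \<open>S(z) = (z;Q)\<^sub>N / (az;Q)\<^sub>N S(zQ\<^sup>N)\<close>,
  and \<open>S(w) \<rightarrow> 1\<close> as \<open>w \<rightarrow> 0\<close>.
\<close>

section \<open>q-Pochhammer symbols: limits, nonvanishing and factorisations\<close>

lemma qpoch_0 [simp]: "qpoch a q 0 = 1"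
  by (simp add: qpoch_def)

lemma qpoch_Suc: "qpoch a q (Suc n) = qpoch a q n * (1 - a * q ^ n)"
  by (simp add: qpoch_def)

lemma qpoch_Suc_shift: "qpoch a q (Suc n) = (1 - a) * qpoch (a * q) q n"
  unfolding qpoch_def by (subst prod.lessThan_Suc_shift) (simp add: mult.assoc)

lemma mult_power_neq_1:
  fixes a q :: complex
  assumes "norm q < 1" "norm a < 1"
  shows "a * q ^ j \<noteq> 1"
proof
  assume "a * q ^ j = 1"
  then have "norm a * norm q ^ j = 1"
    by (metis norm_mult norm_one norm_power)
  moreover have "norm a * norm q ^ j \<le> norm a"
    using assms by (simp add: mult_left_le power_le_one)
  ultimately show False
    using assms by simp
qed

lemma qpoch_tendsto_qpoch_inf:
  assumes "norm q < 1"
  shows "qpoch a q \<longlonglongrightarrow> qpoch_inf a q"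
proof -
  have "(\<lambda>n. \<Prod>j\<le>n. 1 - a * q ^ j) \<longlonglongrightarrow> qpoch_inf a q"
    using has_prod_qpoch_inf[OF assms, of a]
    by (metis convergent_prod_LIMSEQ has_prod_iff)
  then have "(\<lambda>n. qpoch a q (Suc n)) \<longlonglongrightarrow> qpoch_inf a q"
    by (simp add: qpoch_def lessThan_Suc_atMost)
  then show ?thesis
    by (rule LIMSEQ_imp_Suc)
qed

text \<open>In the sense of \<open>has_prod\<close> a product vanishes only if one of its factors
  does. This justifies limits of quotients and the final cancellation.\<close>

lemma qpoch_inf_nonzero:
  assumes "norm q < 1" "\<And>j. a * q ^ j \<noteq> 1"
  shows "qpoch_inf a q \<noteq> 0"
  using has_prod_eq_0_iff[OF has_prod_qpoch_inf[OF assms(1), of a]] assms(2)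
  by auto

text \<open>Among the factors \<open>1 - q ^ k\<close> with 1 \<le> k \<le> 2n, the odd k give one
  symbol in base \<open>q ^ 2\<close> and the even k the other.\<close>

lemma qpoch_even_odd: "qpoch q q (2 * n) = qpoch q (q ^ 2) n * qpoch (q ^ 2) (q ^ 2) n"
proof (induction n)
  case (Suc n)
  have e1: "q ^ (2 * n) = (q ^ 2) ^ n"
    by (rule power_mult)
  have e2: "q * q ^ Suc (2 * n) = q ^ 2 * (q ^ 2) ^ n"
    unfolding e1[symmetric] by (simp add: power2_eq_square)
  have "qpoch q q (2 * Suc n) = qpoch q q (2 * n) * (1 - q * q ^ (2 * n)) * (1 - q * q ^ Suc (2 * n))"
    by (simp add: qpoch_Suc)
  also have "\<dots> = (qpoch q (q ^ 2) n * (1 - q * (q ^ 2) ^ n)) *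
                  (qpoch (q ^ 2) (q ^ 2) n * (1 - q ^ 2 * (q ^ 2) ^ n))"
    unfolding Suc.IH e2 unfolding e1 by (simp only: mult_ac)
  finally show ?case
    by (simp only: qpoch_Suc)
qed simp

lemma qpoch_mult_minus: "qpoch a q n * qpoch (- a) q n = qpoch (a ^ 2) (q ^ 2) n"
proof -
  have "(1 - a * q ^ j) * (1 - (- a) * q ^ j) = 1 - a ^ 2 * (q ^ 2) ^ j" for j
    by (simp add: algebra_simps power2_eq_square power_mult_distrib)
  then show ?thesis
    by (simp add: qpoch_def flip: prod.distrib)
qed

section \<open>The series in z: term ratio, telescoping and functional equation\<close>

text \<open>The exponent \<open>n choose 2\<close> is written as the product of the powers \<open>Q\<^sup>j\<close>, \<open>j < n\<close>.\<close>

definition phi11_term :: "complex \<Rightarrow> complex \<Rightarrow> complex \<Rightarrow> nat \<Rightarrow> complex" where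
  "phi11_term Q a z n =
     qpoch a Q n * (\<Prod>j<n. - z * Q ^ j) / (qpoch (a * z) Q n * qpoch Q Q n)"

lemma phi11_term_0 [simp]: "phi11_term Q a z 0 = 1"
  by (simp add: phi11_term_def)

lemma phi11_term_Suc:
  "phi11_term Q a z (Suc n) =
     phi11_term Q a z n * ((1 - a * Q ^ n) * (- z * Q ^ n) / ((1 - a * z * Q ^ n) * (1 - Q ^ Suc n)))"
  by (simp add: phi11_term_def qpoch_Suc mult_ac)

text \<open>Replacing z by zQ contributes \<open>Q ^ n\<close> to the numerator and drops the first
  factor of \<open>qpoch (a * z) Q\<close> in favour of a new last one. Both series then share a
  common factor, so telescoping reduces to a rational identity in \<open>Q ^ n\<close>.\<close>

lemma phi11_term_shift:
  assumes "\<And>j. a * z * Q ^ j \<noteq> 1"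
  shows "(1 - z) / (1 - a * z) * phi11_term Q a (z * Q) n =
           phi11_term Q a z n * ((1 - z) * Q ^ n / (1 - a * z * Q ^ n))"
proof -
  have p: "(\<Prod>j<n. - (z * Q) * Q ^ j) = Q ^ n * (\<Prod>j<n. - z * Q ^ j)"
    by (induction n) (simp_all add: mult_ac)
  have c: "(1 - a * z) * qpoch (a * (z * Q)) Q n = qpoch (a * z) Q n * (1 - a * z * Q ^ n)"
    by (metis mult.assoc qpoch_Suc qpoch_Suc_shift)
  have "(1 - z) / (1 - a * z) * phi11_term Q a (z * Q) n =
          (1 - z) * (qpoch a Q n * (Q ^ n * (\<Prod>j<n. - z * Q ^ j))) /
          (((1 - a * z) * qpoch (a * (z * Q)) Q n) * qpoch Q Q n)"
    unfolding phi11_term_def p by (simp add: mult.assoc)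
  also have "\<dots> = phi11_term Q a z n * ((1 - z) * Q ^ n / (1 - a * z * Q ^ n))"
    unfolding c phi11_term_def by (simp add: mult_ac)
  finally show ?thesis .
qed

lemma phi11_telescope:
  assumes "norm Q < 1" "\<And>j. a * z * Q ^ j \<noteq> 1"
  shows "phi11_term Q a z n - (1 - z) / (1 - a * z) * phi11_term Q a (z * Q) n =
           phi11_term Q a z n * (1 - Q ^ n) - phi11_term Q a z (Suc n) * (1 - Q ^ Suc n)"
proof -
  have Q: "1 - Q ^ Suc n \<noteq> 0"
    using mult_power_neq_1[OF assms(1) assms(1), of n] by simp
  have c: "1 - a * z * Q ^ n \<noteq> 0"
    using assms(2)[of n] by simp
  have "phi11_term Q a z (Suc n) * (1 - Q ^ Suc n) =
          phi11_term Q a z n * ((1 - a * Q ^ n) * (- z * Q ^ n) / (1 - a * z * Q ^ n))"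
    using Q by (simp add: phi11_term_Suc del: power_Suc)
  \<comment> \<open>With x = \<open>Q ^ n\<close> this is (1 - azx) - (1 - z)x = (1 - x)(1 - azx) +
    zx(1 - ax), divided by 1 - azx.\<close>
  moreover have "1 - (1 - z) * Q ^ n / (1 - a * z * Q ^ n) =
      (1 - Q ^ n) - (1 - a * Q ^ n) * (- z * Q ^ n) / (1 - a * z * Q ^ n)"
    using c by (simp add: divide_simps) (simp add: algebra_simps)
  ultimately show ?thesis
    unfolding phi11_term_shift[OF assms(2)]
    by (metis mult.right_neutral right_diff_distrib)
qed

text \<open>The term ratio contains the factor \<open>Q ^ n\<close> and tends to 0, so the ratio
  test applies for every z; the bound 1/2 is an arbitrary constant below 1.\<close>

lemma summable_phi11_term:
  assumes "norm Q < 1"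
  shows "summable (phi11_term Q a z)"
proof -
  define r where "r n = (1 - a * Q ^ n) * (- z * Q ^ n) / ((1 - a * z * Q ^ n) * (1 - Q ^ Suc n))" for n
  have Qn: "(\<lambda>n. Q ^ n) \<longlonglongrightarrow> 0"
    using assms by (rule LIMSEQ_power_zero)
  have "r \<longlonglongrightarrow> (1 - a * 0) * (- z * 0) / ((1 - a * z * 0) * (1 - 0))"
    unfolding r_def by (intro tendsto_intros Qn LIMSEQ_Suc[OF Qn]) simp
  then have "(\<lambda>n. norm (r n)) \<longlonglongrightarrow> 0"
    by (intro tendsto_norm_zero) simp
  then have "\<forall>\<^sub>F n in sequentially. norm (r n) < 1/2"
    by (rule order_tendstoD(2)) simp
  then obtain N where N: "\<And>n. n \<ge> N \<Longrightarrow> norm (r n) < 1/2"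
    unfolding eventually_sequentially by blast
  show ?thesis
  proof (rule summable_ratio_test[of "1/2" N])
    fix n assume "n \<ge> N"
    moreover have "phi11_term Q a z (Suc n) = phi11_term Q a z n * r n"
      by (simp only: phi11_term_Suc r_def)
    ultimately show "norm (phi11_term Q a z (Suc n)) \<le> 1/2 * norm (phi11_term Q a z n)"
      using mult_left_mono[OF less_imp_le[OF N], of n "norm (phi11_term Q a z n)"]
      by (simp add: norm_mult)
  qed simp
qed

lemma suminf_phi11_shift:
  assumes "norm Q < 1" "\<And>j. a * z * Q ^ j \<noteq> 1"
  shows "suminf (phi11_term Q a z) = (1 - z) / (1 - a * z) * suminf (phi11_term Q a (z * Q))"
proof -
  let ?u = "phi11_term Q a z" and ?v = "phi11_term Q a (z * Q)"
  note s = summable_phi11_term[OF assms(1)]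
  have "(\<lambda>n. 1 - Q ^ n) \<longlonglongrightarrow> 1 - 0"
    by (intro tendsto_intros LIMSEQ_power_zero assms(1))
  then have "(\<lambda>n. ?u n * (1 - Q ^ n)) \<longlonglongrightarrow> 0"
    using tendsto_mult[OF summable_LIMSEQ_zero[OF s]] by fastforce
  \<comment> \<open>The certificate tends to 0 and is also 0 at n = 0, because 1 -
    \<open>Q ^ 0\<close> = 0; both boundary terms vanish.\<close>
  from telescope_sums'[OF this]
  have "(\<lambda>n. ?u n - (1 - z) / (1 - a * z) * ?v n) sums 0"
    unfolding phi11_telescope[OF assms, symmetric] by simp
  moreover have "(\<lambda>n. ?u n - (1 - z) / (1 - a * z) * ?v n) sums
                   (suminf ?u - (1 - z) / (1 - a * z) * suminf ?v)"
    by (intro sums_diff sums_mult summable_sums s)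
  ultimately show ?thesis
    using sums_unique2 by fastforce
qed

lemma suminf_phi11_iterate:
  assumes "norm Q < 1" "\<And>j. a * z * Q ^ j \<noteq> 1"
  shows "suminf (phi11_term Q a z) =
           qpoch z Q N / qpoch (a * z) Q N * suminf (phi11_term Q a (z * Q ^ N))"
proof (induction N)
  case (Suc N)
  have "a * (z * Q ^ N) * Q ^ j \<noteq> 1" for j
    using assms(2)[of "N + j"] by (simp add: power_add mult_ac)
  from suminf_phi11_shift[OF assms(1) this] Suc.IH show ?case
    by (simp add: qpoch_Suc mult_ac)
qed simp

section \<open>Behaviour of the sum near w = 0, and its closed form\<close>

lemma norm_phi11_term_le:
  assumes "norm Q < 1" "norm (a * w) \<le> 1/2"
  shows "norm (phi11_term Q a w n) \<le> ((1 + norm a) * 2 / (1 - norm Q) * norm w) ^ n"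
proof (induction n)
  case (Suc n)
  have Qn: "norm Q ^ n \<le> 1"
    using assms(1) by (simp add: power_le_one)
  \<comment> \<open>A term is a product of n ratios; bounds 1 to 4 control each ratio independently
    of its index, which yields a majorant geometric in \<open>norm w\<close>.\<close>
  have 1: "norm (1 - a * Q ^ n) \<le> 1 + norm a"
    using norm_triangle_ineq4[of 1 "a * Q ^ n"] mult_left_mono[OF Qn, of "norm a"]
    by (simp add: norm_mult norm_power)
  have 2: "norm (- w * Q ^ n) \<le> norm w"
    using mult_left_mono[OF Qn, of "norm w"] by (simp add: norm_mult norm_power)
  have "norm (a * w * Q ^ n) \<le> 1/2"
    using mult_left_mono[OF Qn, of "norm (a * w)"] assms(2)
    by (simp add: norm_mult norm_power)
  then have 3: "1/2 \<le> norm (1 - a * w * Q ^ n)"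
    using norm_triangle_ineq2[of 1 "a * w * Q ^ n"] by simp
  have "norm (Q ^ Suc n) \<le> norm Q"
    using mult_left_mono[OF Qn, of "norm Q"] by (simp add: norm_mult norm_power)
  then have 4: "1 - norm Q \<le> norm (1 - Q ^ Suc n)"
    using norm_triangle_ineq2[of 1 "Q ^ Suc n"] by simp
  have "norm ((1 - a * Q ^ n) * (- w * Q ^ n) / ((1 - a * w * Q ^ n) * (1 - Q ^ Suc n)))
          \<le> ((1 + norm a) * norm w) / (1/2 * (1 - norm Q))"
    unfolding norm_divide norm_mult[of "1 - a * Q ^ n"] norm_mult[of "1 - a * w * Q ^ n"]
    using assms(1) by (intro frac_le mult_mono 1 2 3 4) auto
  also have "\<dots> = (1 + norm a) * 2 / (1 - norm Q) * norm w"
    by simp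
  finally have r: "norm ((1 - a * Q ^ n) * (- w * Q ^ n) / ((1 - a * w * Q ^ n) * (1 - Q ^ Suc n)))
          \<le> (1 + norm a) * 2 / (1 - norm Q) * norm w" .
  show ?case
    unfolding phi11_term_Suc norm_mult[of "phi11_term Q a w n"]
      power_Suc2[of "(1 + norm a) * 2 / (1 - norm Q) * norm w"]
    using assms(1) by (intro mult_mono Suc.IH r) auto
qed simp

text \<open>The term at n = 0 is 1 and the geometric majorant makes the rest
  O(\<open>norm w\<close>). The filter is \<open>nhds 0\<close> rather than \<open>at 0\<close>
  because w will run through \<open>z * Q ^ N\<close>, which may equal 0.\<close>

lemma suminf_phi11_tendsto_1:
  assumes "norm Q < 1"
  shows "((\<lambda>w. suminf (phi11_term Q a w)) \<longlongrightarrow> 1) (nhds 0)"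
proof -
  define K where "K = (1 + norm a) * 2 / (1 - norm Q)"
  have K: "K \<ge> 0"
    using assms by (simp add: K_def)
  have bound: "norm (suminf (phi11_term Q a w) - 1) \<le> 2 * (K * norm w)"
    if aw: "norm (a * w) < 1/2" and Kw: "K * norm w < 1/2" for w
  proof -
    let ?x = "K * norm w"
    have x: "0 \<le> ?x" "?x < 1"
      using K Kw by auto
    have "(\<lambda>n. ?x * ?x ^ n) sums (?x * (1 / (1 - ?x)))"
      using x by (intro sums_mult geometric_sums) simp
    then have geo: "summable (\<lambda>n. ?x ^ Suc n)" "(\<Sum>n. ?x ^ Suc n) = ?x / (1 - ?x)"
      by (simp_all add: sums_iff)
    have "norm (suminf (phi11_term Q a w) - 1) = norm (\<Sum>n. phi11_term Q a w (Suc n))"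
      using suminf_split_head[OF summable_phi11_term[OF assms, of a w]] by simp
    also have "\<dots> \<le> (\<Sum>n. ?x ^ Suc n)"
      using norm_phi11_term_le[OF assms less_imp_le[OF aw]] unfolding K_def[symmetric]
      by (intro norm_suminf_le geo(1))
    also have "\<dots> \<le> ?x / (1/2)"
      unfolding geo(2) using x Kw by (intro divide_left_mono) auto
    finally show ?thesis by simp
  qed
  have id: "((\<lambda>w. w) \<longlongrightarrow> (0::complex)) (nhds 0)"
    by (rule filterlim_ident)
  have nrm: "((\<lambda>w. c * norm w) \<longlongrightarrow> 0) (nhds (0::complex))" for c :: real
    by (intro tendsto_mult_right_zero tendsto_norm_zero id)
  have ev: "\<forall>\<^sub>F w in nhds 0. norm (a * w) < 1/2" "\<forall>\<^sub>F w in nhds (0::complex). K * norm w < 1/2"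
    unfolding norm_mult by (rule order_tendstoD(2)[OF nrm]; simp)+
  have "((\<lambda>w. 2 * (K * norm w)) \<longlongrightarrow> 0) (nhds (0::complex))"
    by (intro tendsto_mult_right_zero nrm)
  moreover have "\<forall>\<^sub>F w in nhds 0. norm (suminf (phi11_term Q a w) - 1) \<le> 2 * (K * norm w)"
    using ev by eventually_elim (rule bound)
  ultimately have "((\<lambda>w. suminf (phi11_term Q a w) - 1) \<longlongrightarrow> 0) (nhds 0)"
    by (rule Lim_null_comparison[rotated])
  then show ?thesis
    by (rule LIM_zero_cancel)
qed

text \<open>The classical summation of \<open>\<^sub>1\<phi>\<^sub>1\<close> with lower parameter c
  and argument c/a, written with c = az so that no division by a occurs.\<close>

theorem phi11_sums:
  assumes "norm Q < 1" "\<And>j. a * z * Q ^ j \<noteq> 1"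
  shows "phi11_term Q a z sums (qpoch_inf z Q / qpoch_inf (a * z) Q)"
proof -
  have "(\<lambda>N. z * Q ^ N) \<longlonglongrightarrow> z * 0"
    by (intro tendsto_intros LIMSEQ_power_zero assms(1))
  then have "(\<lambda>N. suminf (phi11_term Q a (z * Q ^ N))) \<longlonglongrightarrow> 1"
    using filterlim_compose[OF suminf_phi11_tendsto_1[OF assms(1)]] by simp
  then have "(\<lambda>N. qpoch z Q N / qpoch (a * z) Q N * suminf (phi11_term Q a (z * Q ^ N)))
               \<longlonglongrightarrow> qpoch_inf z Q / qpoch_inf (a * z) Q * 1"
    using assms by (intro tendsto_intros qpoch_tendsto_qpoch_inf qpoch_inf_nonzero)
  \<comment> \<open>By the iterated functional equation the sequence in N is constant, so its value
    is the limit.\<close>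
  then have "suminf (phi11_term Q a z) = qpoch_inf z Q / qpoch_inf (a * z) Q"
    unfolding suminf_phi11_iterate[OF assms, symmetric] by (simp add: LIMSEQ_const_iff)
  then show ?thesis
    using summable_sums[OF summable_phi11_term[OF assms(1), of a z]] by simp
qed

section \<open>Specialisation to base \<open>q ^ 2\<close> and the second product form\<close>

lemma qpoch_inf_Suc_shift:
  assumes "norm q < 1"
  shows "qpoch_inf a q = (1 - a) * qpoch_inf (a * q) q"
proof -
  have "(\<lambda>n. qpoch a q (Suc n)) \<longlonglongrightarrow> (1 - a) * qpoch_inf (a * q) q"
    unfolding qpoch_Suc_shift by (intro tendsto_intros qpoch_tendsto_qpoch_inf assms)
  then show ?thesis
    by (rule LIMSEQ_unique[OF LIMSEQ_Suc[OF qpoch_tendsto_qpoch_inf[OF assms]]])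
qed

lemma prod_q_squared_powers: "(\<Prod>j<n. q ^ 2 * (q ^ 2) ^ j) = (q :: complex) ^ (n ^ 2 + n)"
  by (induction n) (simp_all add: power_add power2_eq_square power_mult_distrib mult_ac)

theorem mainTheorem6:
  fixes q :: complex
  assumes "norm q < 1"
  shows "(\<lambda>n. qpoch (-q) (q ^ 2) n * q ^ (n ^ 2 + n) / qpoch q q (2 * n + 1))
           sums (qpoch_inf (- (q ^ 2)) (q ^ 2) / qpoch_inf q (q ^ 2)) \<and>
         qpoch_inf (- (q ^ 2)) (q ^ 2) / qpoch_inf q (q ^ 2) = qpoch_inf (q ^ 4) (q ^ 4) / qpoch_inf q q"
proof
  have Q: "norm (q ^ 2) < 1" and q4: "norm (q ^ 4) < 1"
    using assms by (simp_all add: norm_power power_less_one_iff)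
  have c: "- q * - (q ^ 2) = q * q ^ 2"
    by simp
  have "norm (q * q ^ 2) < 1"
    using assms Q mult_strict_mono[of "norm q" 1 "norm (q ^ 2)" 1] by (simp add: norm_mult)
  then have "- q * - (q ^ 2) * (q ^ 2) ^ j \<noteq> 1" for j
    unfolding c by (rule mult_power_neq_1[OF Q])
  \<comment> \<open>Here az = \<open>q ^ 3\<close>; the factor 1 - q supplies the missing first
    factor that turns \<open>qpoch_inf (q * q ^ 2) (q ^ 2)\<close> into
    \<open>qpoch_inf q (q ^ 2)\<close>.\<close>
  from sums_divide[OF phi11_sums[OF Q this], of "1 - q"]
  have "(\<lambda>n. phi11_term (q ^ 2) (- q) (- (q ^ 2)) n / (1 - q)) sums
          (qpoch_inf (- (q ^ 2)) (q ^ 2) / qpoch_inf q (q ^ 2))"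
    unfolding c by (simp add: qpoch_inf_Suc_shift[OF Q, of q] mult.commute)
  moreover have "phi11_term (q ^ 2) (- q) (- (q ^ 2)) n / (1 - q) =
      qpoch (-q) (q ^ 2) n * q ^ (n ^ 2 + n) / qpoch q q (2 * n + 1)" for n
  proof -
    have "qpoch q q (2 * n + 1) = qpoch q (q ^ 2) (Suc n) * qpoch (q ^ 2) (q ^ 2) n"
      by (simp add: qpoch_Suc qpoch_even_odd power_mult)
    also have "\<dots> = (1 - q) * qpoch (q * q ^ 2) (q ^ 2) n * qpoch (q ^ 2) (q ^ 2) n"
      by (simp only: qpoch_Suc_shift)
    finally show ?thesis
      unfolding phi11_term_def c minus_minus prod_q_squared_powers by (simp add: mult_ac)
  qed
  ultimately show "(\<lambda>n. qpoch (-q) (q ^ 2) n * q ^ (n ^ 2 + n) / qpoch q q (2 * n + 1))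
           sums (qpoch_inf (- (q ^ 2)) (q ^ 2) / qpoch_inf q (q ^ 2))"
    by simp

  have nz: "qpoch_inf q (q ^ 2) \<noteq> 0" "qpoch_inf q q \<noteq> 0" "qpoch_inf (q ^ 2) (q ^ 2) \<noteq> 0"
    by (intro qpoch_inf_nonzero mult_power_neq_1 assms Q)+
  \<comment> \<open>The limit along even indices is computed in two ways to carry the parity
    splitting over to infinite products.\<close>
  have "(\<lambda>n. qpoch q q (2 * n)) \<longlonglongrightarrow> qpoch_inf q q"
    using LIMSEQ_subseq_LIMSEQ[OF qpoch_tendsto_qpoch_inf[OF assms], of "\<lambda>n. 2 * n"]
    by (simp add: strict_mono_def o_def)
  moreover have "(\<lambda>n. qpoch q q (2 * n)) \<longlonglongrightarrow> qpoch_inf q (q ^ 2) * qpoch_inf (q ^ 2) (q ^ 2)"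
    unfolding qpoch_even_odd by (intro tendsto_intros qpoch_tendsto_qpoch_inf Q)
  ultimately have 1: "qpoch_inf q q = qpoch_inf q (q ^ 2) * qpoch_inf (q ^ 2) (q ^ 2)"
    by (rule LIMSEQ_unique)
  \<comment> \<open>Pairing (1 - x)(1 + x) = 1 - x^2 gives the numerator in base
    \<open>q ^ 4\<close>; the common factor \<open>qpoch_inf (q ^ 2) (q ^ 2)\<close> then cancels
    against the one in fact 1.\<close>
  have "qpoch (q ^ 2) (q ^ 2) n * qpoch (- (q ^ 2)) (q ^ 2) n = qpoch (q ^ 4) (q ^ 4) n" for n
    by (simp add: qpoch_mult_minus flip: power_mult)
  then have "(\<lambda>n. qpoch (q ^ 4) (q ^ 4) n) \<longlonglongrightarrow>
               qpoch_inf (q ^ 2) (q ^ 2) * qpoch_inf (- (q ^ 2)) (q ^ 2)"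
    using tendsto_mult[OF qpoch_tendsto_qpoch_inf[OF Q, of "q ^ 2"]
        qpoch_tendsto_qpoch_inf[OF Q, of "- (q ^ 2)"]]
    by simp
  then have 2: "qpoch_inf (q ^ 4) (q ^ 4) = qpoch_inf (q ^ 2) (q ^ 2) * qpoch_inf (- (q ^ 2)) (q ^ 2)"
    by (rule LIMSEQ_unique[OF qpoch_tendsto_qpoch_inf[OF q4]])
  show "qpoch_inf (- (q ^ 2)) (q ^ 2) / qpoch_inf q (q ^ 2) = qpoch_inf (q ^ 4) (q ^ 4) / qpoch_inf q q"
    using nz by (simp add: 1 2)
qed

end
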